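(* Let $S\neq\mathbb Z_{\ge 0}$ be a numerical semigroup, let $m\in S$ be nonzero, and let $c_1<\dots<c_n$ be the elements of $\mathbb Z_{\ge 0}\setminus S$. Let $f$ be an arbitrary function on $\mathbb Z_{\ge 0}$ with values in a commutative ring $R$ with unity, let $z$ be an indeterminate, and let $p$ be an integer with $0<p\le m$. Then in $R[z]$ $$\sum_{i=1}^n\bigl(f(c_i+m)-f(c_i)\bigr)\Bigl(\sum_{J\subset T_i,\ |J|=p-1}\ \prod_{a\in J}(z+f(a))\Bigr)=\sum_{I\subset S^{(m)},\ |I|=p}\ \prod_{a\in I}(z+f(a))-\sum_{I\subset I_m,\ |I|=p}\ \prod_{a\in I}(z+f(a)).$$ In particular, for $p=m$, $$\sum_{i=1}^n\bigl(f(c_i+m)-f(c_i)\bigr)\prod_{a\in T_i}(z+f(a))=\prod_{a\in S^{(m)}}(z+f(a))-\prod_{a\in I_m}(z+f(a)).$$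
   Context: A numerical semigroup is a set $S\subset\mathbb Z_{\ge 0}$ that contains $0$, is closed under addition and has finite complement in $\mathbb Z_{\ge 0}$. For a numerical semigroup $S$ and a nonzero $m\in S$, the Apéry set is $S^{(m)}:=\{s\in S: s-m\notin S\}$; it has exactly $m$ elements, one in each residue class mod $m$, and contains $0$. Put $I_m:=\{0,1,\dots,m-1\}$. With $\mathbb Z_{\ge 0}\setminus S=\{c_1<\dots<c_n\}$, let $S_0:=\mathbb Z_{\ge 0}$ and $S_i:=\mathbb Z_{\ge 0}\setminus\{c_1,\dots,c_i\}$ for $i=1,\dots,n$ (so $S_n=S$); each $S_i$ is a numerical semigroup containing $m$. For $i=1,\dots,n$ put $T_i:=S_i^{(m)}\setminus\{c_i+m\}=S_{i-1}^{(m)}\setminus\{c_i\}$, a set of $m-1$ elements. Empty products equal $1$. *)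

theory Defs
  imports "HOL-Computational_Algebra.Polynomial"
begin

definition numerical_semigroup :: "nat set \<Rightarrow> bool" where
  "numerical_semigroup S \<longleftrightarrow>
     0 \<in> S \<and> (\<forall>a\<in>S. \<forall>b\<in>S. a + b \<in> S) \<and> finite (- S)"

(* The difference s - m is taken in the integers, since it truncates on nat. *)
definition apery :: "nat set \<Rightarrow> nat \<Rightarrow> nat set" where
  "apery S m = {s \<in> S. int s - int m \<notin> int ` S}"

(* In the next two definitions c enumerates the gaps, indexed from 1. *)
definition gap_chain :: "(nat \<Rightarrow> nat) \<Rightarrow> nat \<Rightarrow> nat set" where
  "gap_chain c i = UNIV - c ` {1..i}"

definition T_set :: "(nat \<Rightarrow> nat) \<Rightarrow> nat \<Rightarrow> nat \<Rightarrow> nat set" where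
  "T_set c m i = apery (gap_chain c i) m - {c i + m}"

(* The polynomial z + f(a), where z is the indeterminate. *)
abbreviation lin :: "(nat \<Rightarrow> 'a::comm_ring_1) \<Rightarrow> nat \<Rightarrow> 'a poly" where
  "lin f a \<equiv> [:f a, 1:]"

end

theory Submission
  imports Defs
begin

text \<open>
  Passing from \<open>S\<^bsub>i-1\<^esub>\<close> to \<open>S\<^bsub>i\<^esub>\<close> removes the gap \<open>c\<^bsub>i\<^esub>\<close>
  and changes the Apery set in a single element: \<open>c\<^bsub>i\<^esub>\<close> is replaced by \<open>c\<^bsub>i\<^esub> + m\<close>, the other
  elements forming \<open>T\<^bsub>i\<^esub>\<close>. An elementary symmetric polynomial is affine in each of its
  arguments, so the \<open>i\<close>-th summand is its increment along this replacement, and the sum telescopes.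
\<close>

text \<open>A negative integer is not the image of a natural number, so under the guard
  \<open>m \<le> s\<close> truncated subtraction is faithful.\<close>

lemma mem_apery_iff: "s \<in> apery X m \<longleftrightarrow> s \<in> X \<and> (m \<le> s \<longrightarrow> s - m \<notin> X)"
proof -
  have "int s - int m \<in> int ` X \<longleftrightarrow> m \<le> s \<and> s - m \<in> X"
  proof
    assume "int s - int m \<in> int ` X"
    then obtain x where "x \<in> X" "int s - int m = int x" by blast
    moreover from this(2) have "s = x + m" by linarith
    ultimately show "m \<le> s \<and> s - m \<in> X" by simp
  next
    assume "m \<le> s \<and> s - m \<in> X"
    then show "int s - int m \<in> int ` X"
      by (metis image_eqI of_nat_diff)
  qed
  then show ?thesis by (auto simp: apery_def)
qed

lemma apery_UNIV: "apery UNIV m = {0..<m}"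
  by (auto simp: mem_apery_iff)

lemma finite_apery:
  assumes "finite (- X)"
  shows "finite (apery X m)"
proof (rule finite_subset)
  show "apery X m \<subseteq> {..<m} \<union> (\<lambda>x. x + m) ` (- X)"
  proof
    fix s assume "s \<in> apery X m"
    then have "s < m \<or> s = (s - m) + m \<and> s - m \<in> - X"
      by (auto simp: mem_apery_iff)
    then show "s \<in> {..<m} \<union> (\<lambda>x. x + m) ` (- X)" by blast
  qed
qed (use assms in simp)

text \<open>Deleting \<open>g\<close> affects only two candidates: \<open>g\<close> itself, and
  \<open>g + m\<close>, which qualifies once its predecessor \<open>g\<close> is gone. As
  \<open>m\<close> is nonzero, these two are distinct.\<close>

lemma apery_remove:
  assumes "m \<noteq> 0" "g \<in> apery X m" "g + m \<in> X"
  shows "apery (X - {g}) m = insert (g + m) (apery X m - {g})"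
  using assms by (auto simp: mem_apery_iff)

text \<open>Gaps are removed in increasing order. Hence, when \<open>c i\<close> is about to go,
  \<open>c i - m\<close> (if nonnegative) is already missing while \<open>c i + m\<close> is still
  present, so \<open>apery_remove\<close> applies.\<close>

lemma gap_chain_apery_step:
  assumes S: "numerical_semigroup S" and m: "m \<in> S" "m \<noteq> 0"
    and mono: "strict_mono_on {1..n} c" and gaps: "c ` {1..n} = UNIV - S"
    and i: "i \<in> {1..n}"
  shows "apery (gap_chain c i) m = insert (c i + m) (T_set c m i)"
    and "apery (gap_chain c (i - 1)) m = insert (c i) (T_set c m i)"
    and "c i \<notin> T_set c m i"
proof -
  let ?X = "gap_chain c (i - 1)"
  have less_iff: "c j < c k \<longleftrightarrow> j < k" if "j \<in> {1..n}" "k \<in> {1..n}" for j k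
    using strict_mono_on_less[OF mono that] .
  have gap: "c i \<notin> S" using gaps i by blast
  have "{1..i} = insert i {1..i - 1}" using i by auto
  then have X_remove: "gap_chain c i = ?X - {c i}"
    by (auto simp: gap_chain_def)
  have smaller: "c j < c i" if "j \<in> {1..i - 1}" for j
    using less_iff[of j i] that i by auto
  have "c i \<in> ?X" and shift: "c i + m \<in> ?X"
    using smaller by (fastforce simp: gap_chain_def)+
  moreover have "c i - m \<notin> ?X" if "m \<le> c i"
  proof -
    \<comment> \<open>Otherwise adding \<open>m\<close> would put the gap \<open>c i\<close> into
      \<open>S\<close>.\<close>
    have "c i - m \<notin> S"
      using S m(1) gap that unfolding numerical_semigroup_def
      by (metis le_add_diff_inverse2)
    then obtain j where j: "j \<in> {1..n}" "c i - m = c j"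
      using gaps by (metis Diff_iff UNIV_I imageE)
    then have "j < i" using less_iff[of j i] i that m(2) by linarith
    then show ?thesis using j by (auto simp: gap_chain_def)
  qed
  ultimately have mem: "c i \<in> apery ?X m" by (simp add: mem_apery_iff)
  have step: "apery (gap_chain c i) m = insert (c i + m) (apery ?X m - {c i})"
    unfolding X_remove using m(2) mem shift by (rule apery_remove)
  \<comment> \<open>Since \<open>c i + m\<close> is new, deleting it from the later Apery set leaves
    the earlier one without \<open>c i\<close>: both descriptions of \<open>T_set c m i\<close>
    agree.\<close>
  have "c i + m \<notin> apery ?X m"
    using \<open>c i \<in> ?X\<close> by (simp add: mem_apery_iff)
  then have T: "T_set c m i = apery ?X m - {c i}"
    unfolding T_set_def step by blast
  show "apery (gap_chain c i) m = insert (c i + m) (T_set c m i)"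
    using step T by simp
  show "apery ?X m = insert (c i) (T_set c m i)" "c i \<notin> T_set c m i"
    using mem T by auto
qed

lemma finite_T_set: "finite (T_set c m i)"
  unfolding T_set_def gap_chain_def by (simp add: finite_apery Compl_eq_Diff_UNIV[symmetric])

text \<open>Split the \<open>p\<close>-subsets by whether they contain \<open>x\<close>; those that
  do are \<open>insert x\<close> of the \<open>(p - 1)\<close>-subsets of \<open>A\<close>. Here
  \<open>0 < p\<close> keeps \<open>p - 1\<close> from truncating.\<close>

lemma sum_prod_subsets_insert:
  fixes h :: "'b \<Rightarrow> 'a::comm_semiring_1"
  assumes "finite A" "x \<notin> A" "0 < p"
  shows "(\<Sum>J | J \<subseteq> insert x A \<and> card J = p. \<Prod>a\<in>J. h a) =
    (\<Sum>J | J \<subseteq> A \<and> card J = p. \<Prod>a\<in>J. h a) +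
    h x * (\<Sum>J | J \<subseteq> A \<and> card J = p - 1. \<Prod>a\<in>J. h a)"
proof -
  let ?P = "\<lambda>k. {J. J \<subseteq> A \<and> card J = k}"
  have fin: "finite (?P k)" for k using assms(1) by simp
  have finJ: "finite J" if "J \<subseteq> A" for J using assms(1) that by (rule finite_subset[rotated])
  have split: "{J. J \<subseteq> insert x A \<and> card J = p} = ?P p \<union> insert x ` ?P (p - 1)"
  proof (intro equalityI subsetI)
    fix J assume "J \<in> {J. J \<subseteq> insert x A \<and> card J = p}"
    then have J: "J \<subseteq> insert x A" "card J = p" by auto
    show "J \<in> ?P p \<union> insert x ` ?P (p - 1)"
    proof (cases "x \<in> J")
      case True
      then have "J = insert x (J - {x})" "J - {x} \<in> ?P (p - 1)"
        using J by (auto simp: card_Diff_singleton)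
      then show ?thesis by blast
    qed (use J in auto)
  next
    fix J assume "J \<in> ?P p \<union> insert x ` ?P (p - 1)"
    then show "J \<in> {J. J \<subseteq> insert x A \<and> card J = p}"
    proof
      assume "J \<in> insert x ` ?P (p - 1)"
      then obtain K where K: "J = insert x K" "K \<subseteq> A" "card K = p - 1" by auto
      then have "card J = Suc (card K)"
        using finJ[of K] assms(2) by (metis card_insert_disjoint subsetD)
      then show ?thesis using K assms(3) by auto
    qed auto
  qed
  have inj: "inj_on (insert x) (?P (p - 1))"
  proof (rule inj_onI)
    fix J K assume "J \<in> ?P (p - 1)" "K \<in> ?P (p - 1)" "insert x J = insert x K"
    moreover from this(1,2) have "x \<notin> J" "x \<notin> K" using assms(2) by auto
    ultimately show "J = K" by (simp add: insert_ident)
  qed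
  have "(\<Sum>J | J \<subseteq> insert x A \<and> card J = p. \<Prod>a\<in>J. h a) =
      (\<Sum>J\<in>?P p. \<Prod>a\<in>J. h a) + (\<Sum>J\<in>insert x ` ?P (p - 1). \<Prod>a\<in>J. h a)"
    unfolding split using fin assms(2) by (intro sum.union_disjoint) auto
  also have "(\<Sum>J\<in>insert x ` ?P (p - 1). \<Prod>a\<in>J. h a) = (\<Sum>J\<in>?P (p - 1). h x * (\<Prod>a\<in>J. h a))"
    unfolding sum.reindex[OF inj] o_def
  proof (rule sum.cong)
    fix J assume "J \<in> ?P (p - 1)"
    then show "(\<Prod>a\<in>insert x J. h a) = h x * (\<Prod>a\<in>J. h a)"
      using finJ[of J] assms(2) by (subst prod.insert) auto
  qed simp
  finally show ?thesis by (simp add: sum_distrib_left)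
qed

theorem mainTheorem1:
  fixes S :: "nat set" and m n :: nat and c :: "nat \<Rightarrow> nat"
    and f :: "nat \<Rightarrow> 'a::comm_ring_1"
  assumes "numerical_semigroup S" and "S \<noteq> UNIV"
    and "m \<in> S" and "m \<noteq> 0"
    and "strict_mono_on {1..n} c" and "c ` {1..n} = UNIV - S"
  shows "(\<forall>p. 0 < p \<and> p \<le> m \<longrightarrow>
            (\<Sum>i=1..n. [:f (c i + m) - f (c i):] *
               (\<Sum>J | J \<subseteq> T_set c m i \<and> card J = p - 1. \<Prod>a\<in>J. lin f a))
          = (\<Sum>I | I \<subseteq> apery S m \<and> card I = p. \<Prod>a\<in>I. lin f a)
            - (\<Sum>I | I \<subseteq> {0..<m} \<and> card I = p. \<Prod>a\<in>I. lin f a))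
       \<and> (\<Sum>i=1..n. [:f (c i + m) - f (c i):] * (\<Prod>a\<in>T_set c m i. lin f a))
          = (\<Prod>a\<in>apery S m. lin f a) - (\<Prod>a\<in>{0..<m}. lin f a)"
proof -
  let ?A = "\<lambda>i. apery (gap_chain c i) m"
  have A_0: "?A 0 = {0..<m}" by (simp add: gap_chain_def apery_UNIV)
  have A_n: "?A n = apery S m"
    using assms(6) by (simp add: gap_chain_def double_diff)
  note step = gap_chain_apery_step[OF assms(1,3,4,5,6)]
  have notin: "c i + m \<notin> T_set c m i" for i by (simp add: T_set_def)
  \<comment> \<open>Stated for an abstract \<open>F\<close> to serve both claims: along the exchange
    at \<open>i\<close>, \<open>F\<close> is affine in \<open>lin f x\<close> with slope
    \<open>G i\<close> and constant part \<open>H i\<close>, neither depending on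
    \<open>x\<close>.\<close>
  have telescope: "(\<Sum>i=1..n. [:f (c i + m) - f (c i):] * G i) = F (apery S m) - F {0..<m}"
    if F: "\<And>i x. i \<in> {1..n} \<Longrightarrow> x \<notin> T_set c m i \<Longrightarrow>
      F (insert x (T_set c m i)) = H i + lin f x * G i" for F and G H :: "nat \<Rightarrow> 'a poly"
  proof -
    have "[:f (c i + m) - f (c i):] * G i = F (?A i) - F (?A (i - 1))" if i: "i \<in> {1..n}" for i
    proof -
      \<comment> \<open>The parts \<open>H i\<close> cancel, and so does the indeterminate in the
        difference of the two linear factors, leaving a constant polynomial.\<close>
      have "F (?A i) - F (?A (i - 1)) = (lin f (c i + m) - lin f (c i)) * G i"
        unfolding step(1,2)[OF i] F[OF i notin] F[OF i step(3)[OF i]]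
        by (simp only: left_diff_distrib add_diff_cancel_left)
      then show ?thesis by simp
    qed
    then have "(\<Sum>i=1..n. [:f (c i + m) - f (c i):] * G i) = (\<Sum>i=1..n. F (?A i) - F (?A (i - 1)))"
      by (rule sum.cong[OF refl])
    also have "\<dots> = F (?A n) - F (?A 0)"
      using sum_telescope''[of 0 n "\<lambda>i. F (?A i)"] by simp
    finally show ?thesis by (simp only: A_0 A_n)
  qed
  show ?thesis
  proof (intro conjI allI impI, goal_cases)
    case (1 p)
    then have "0 < p" by simp
    then show ?case
      by (intro telescope[OF sum_prod_subsets_insert[OF finite_T_set]])
  next
    case 2
    show ?case
      \<comment> \<open>In the full product every term carries the factor of \<open>x\<close>, so
        the constant part is 0.\<close>
      by (rule telescope[where H = "\<lambda>_. 0"]) (simp only: prod.insert finite_T_set not_False_eq_True add_0_left)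
  qed
qed

end
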